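(* Let $I=\{1,\dots,m\}$, $J=\{1,\dots,n\}$, and consider the interval transportation problem (ITP$^\le$) with interval data $\mathbf{c}=[\underline{c},\overline{c}]$, $\mathbf{s}=[\underline{s},\overline{s}]$, $\mathbf{d}=[\underline{d},\overline{d}]$. A given $x\in\mathbb{R}^{m\times n}$ is a weakly optimal solution of (ITP$^\le$) if and only if it is a weakly feasible solution of (ITP$^\le$) and the following linear system with variables $u_i$ ($i\in I$), $v_j$ ($j\in J$) and $c_{ij}$ ($i\in I, j\in J$), all real, is feasible: $$\begin{aligned} \sum_{i\in I}\sum_{j\in J} c_{ij}x_{ij} &= \sum_{i\in I} s_i u_i+\sum_{j\in J} d_j v_j,\\ u_i+v_j &\le c_{ij}, && \forall i\in I,\ j\in J,\\ u_i &\le 0, && \forall i\in I,\\ \underline{c}_{ij}\le c_{ij} &\le \overline{c}_{ij}, && \forall i\in I,\ j\in J, \end{aligned}$$ where $s_i=\max\{\underline{s}_i,\ \sum_{j\in J}x_{ij}\}$ for $i \in I$ and $d_j=\sum_{i\in I}x_{ij}$ for $j \in J$ (these are constants determined by $x$).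
   Context: For real vectors (or matrices) $\underline{a}\le\overline{a}$ (element-wise), $\mathbf{a}=[\underline{a},\overline{a}]=\{a:\underline{a}\le a\le\overline{a}\}$ denotes an interval vector (or matrix). Given non-negative interval data: costs $\mathbf{c}=[\underline{c},\overline{c}]$ with $\underline{c},\overline{c}\in\mathbb{R}^{m\times n}$, supplies $\mathbf{s}=[\underline{s},\overline{s}]$ with $\underline{s},\overline{s}\in\mathbb{R}^m$, demands $\mathbf{d}=[\underline{d},\overline{d}]$ with $\underline{d},\overline{d}\in\mathbb{R}^n$ (all lower bounds are $\ge 0$), the interval transportation problem (ITP$^\le$) is the family of all linear programs $$\text{minimize }\sum_{i\in I}\sum_{j\in J}c_{ij}x_{ij}\ \text{ subject to }\ \sum_{j\in J}x_{ij}\le s_i\ (\forall i\in I),\quad \sum_{i\in I}x_{ij}=d_j\ (\forall j\in J),\quad x_{ij}\ge 0\ (\forall i\in I,j\in J),$$ with $c\in\mathbf{c}$, $s\in\mathbf{s}$, $d\in\mathbf{d}$. Each such linear program is called the scenario $(c,s,d)$. A given $x\in\mathbb{R}^{m\times n}$ is a weakly feasible (respectively weakly optimal) solution if it is feasible (respectively an optimal solution) for at least one scenario $(c,s,d)$ with $c\in\mathbf{c}$, $s\in\mathbf{s}$, $d\in\mathbf{d}$. *)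

theory Defs
  imports "HOL-Analysis.Analysis"
begin

(* Sources are indexed by the finite type 'm, destinations by the finite type 'n, and
   x $ i $ j is the amount shipped from source i to destination j. *)

definition tp_cost :: "real ^ 'n ^ 'm \<Rightarrow> real ^ 'n ^ 'm \<Rightarrow> real"
  where "tp_cost c x = (\<Sum>i\<in>UNIV. \<Sum>j\<in>UNIV. c $ i $ j * x $ i $ j)"

definition tp_feasible :: "real ^ 'm \<Rightarrow> real ^ 'n \<Rightarrow> real ^ 'n ^ 'm \<Rightarrow> bool"
  where "tp_feasible s d x \<longleftrightarrow>
    (\<forall>i. (\<Sum>j\<in>UNIV. x $ i $ j) \<le> s $ i) \<and>
    (\<forall>j. (\<Sum>i\<in>UNIV. x $ i $ j) = d $ j) \<and>
    (\<forall>i j. 0 \<le> x $ i $ j)"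

definition tp_optimal ::
    "real ^ 'n ^ 'm \<Rightarrow> real ^ 'm \<Rightarrow> real ^ 'n \<Rightarrow> real ^ 'n ^ 'm \<Rightarrow> bool"
  where "tp_optimal c s d x \<longleftrightarrow>
    tp_feasible s d x \<and> (\<forall>y. tp_feasible s d y \<longrightarrow> tp_cost c x \<le> tp_cost c y)"

(* The interval data enter as sets {lo..hi}; the order on real ^ 'n and on real ^ 'n ^ 'm
   is element-wise. *)

definition itp_weakly_feasible ::
    "(real ^ 'n ^ 'm) set \<Rightarrow> (real ^ 'm) set \<Rightarrow> (real ^ 'n) set \<Rightarrow> real ^ 'n ^ 'm \<Rightarrow> bool"
  where "itp_weakly_feasible C S D x \<longleftrightarrow> (\<exists>c\<in>C. \<exists>s\<in>S. \<exists>d\<in>D. tp_feasible s d x)"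

definition itp_weakly_optimal ::
    "(real ^ 'n ^ 'm) set \<Rightarrow> (real ^ 'm) set \<Rightarrow> (real ^ 'n) set \<Rightarrow> real ^ 'n ^ 'm \<Rightarrow> bool"
  where "itp_weakly_optimal C S D x \<longleftrightarrow> (\<exists>c\<in>C. \<exists>s\<in>S. \<exists>d\<in>D. tp_optimal c s d x)"

end

theory Submission
  imports Defs
begin

text \<open>
  For one fixed scenario the linear system without the bounds on \<^term>\<open>c\<close> is linear programming
  duality: a feasible \<^term>\<open>x\<close> is optimal iff some dual feasible pair \<^term>\<open>(u, v)\<close> attains the
  same objective value (\<open>tp_optimal_iff_dual\<close>). The proposition lets the cost matrix range over its
  interval, but it has only one supply vector and one demand vector. This suffices for the
  following reason. Feasibility of \<^term>\<open>x\<close> forces the demands to be its column sums, and a supply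
  vector in the interval admits \<^term>\<open>x\<close> iff it dominates
  \<open>max s_lo (row sums of x)\<close>. Lowering the supplies to that least admissible vector only shrinks
  the set of competitors (\<open>tp_optimal_antimono_supply\<close>), so an \<^term>\<open>x\<close> that is optimal in any
  scenario with costs \<^term>\<open>c\<close> is optimal for \<^term>\<open>c\<close> with the least supplies.

  Weak duality is a computation. For strong duality, the costs for which \<^term>\<open>x\<close> has
  complementary potentials form a convex cone. It contains an explicit finite set of matrices,
  hence also their convex conic hull, which is closed. If the cost matrix lay outside that hull, a separating
  hyperplane would provide a direction along which \<^term>\<open>x\<close> can be moved inside the feasible set
  at decreasing cost, contradicting optimality.
\<close>

section \<open>Weak duality and complementary slackness\<close>

lemma tp_cost_eq_inner: "tp_cost c x = c \<bullet> x"
  by (simp add: tp_cost_def inner_vec_def)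

definition tp_dual_value :: "real ^ 'm \<Rightarrow> real ^ 'n \<Rightarrow> real ^ 'm \<Rightarrow> real ^ 'n \<Rightarrow> real"
  where "tp_dual_value s d u v = (\<Sum>i\<in>UNIV. s $ i * u $ i) + (\<Sum>j\<in>UNIV. d $ j * v $ j)"

definition tp_dual_feasible :: "real ^ 'n ^ 'm \<Rightarrow> real ^ 'm \<Rightarrow> real ^ 'n \<Rightarrow> bool"
  where "tp_dual_feasible c u v \<longleftrightarrow> (\<forall>i j. u $ i + v $ j \<le> c $ i $ j) \<and> (\<forall>i. u $ i \<le> 0)"

text \<open>
  The duality gap splits into the reduced costs paid on the shipments and the prices of the unused
  supplies. Both summands are nonnegative for a primal-dual feasible pair, which is weak duality;
  both vanish under complementary slackness, which is how equality arises in strong duality.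
\<close>
lemma duality_gap_eq:
  fixes c :: "real ^ 'n ^ 'm" and x :: "real ^ 'n ^ 'm"
  assumes "tp_feasible s d x"
  shows "tp_cost c x - tp_dual_value s d u v =
    (\<Sum>i\<in>UNIV. \<Sum>j\<in>UNIV. (c $ i $ j - u $ i - v $ j) * x $ i $ j)
    + (\<Sum>i\<in>UNIV. (s $ i - (\<Sum>j\<in>UNIV. x $ i $ j)) * (- u $ i))"
proof -
  have "(\<Sum>j\<in>UNIV. d $ j * v $ j) = (\<Sum>j\<in>UNIV. \<Sum>i\<in>UNIV. x $ i $ j * v $ j)"
    using assms by (simp add: tp_feasible_def flip: sum_distrib_right)
  also have "\<dots> = (\<Sum>i\<in>UNIV. \<Sum>j\<in>UNIV. x $ i $ j * v $ j)"
    by (rule sum.swap)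
  finally show ?thesis
    by (simp add: tp_cost_def tp_dual_value_def algebra_simps sum.distrib sum_subtractf
        sum_negf sum_distrib_left)
qed

lemma weak_duality:
  assumes "tp_feasible s d x" and "tp_dual_feasible c u v"
  shows "tp_dual_value s d u v \<le> tp_cost c x"
proof -
  have "0 \<le> (\<Sum>i\<in>UNIV. \<Sum>j\<in>UNIV. (c $ i $ j - u $ i - v $ j) * x $ i $ j)"
    using assms by (intro sum_nonneg mult_nonneg_nonneg)
      (auto simp: tp_feasible_def tp_dual_feasible_def diff_diff_eq)
  moreover have "0 \<le> (\<Sum>i\<in>UNIV. (s $ i - (\<Sum>j\<in>UNIV. x $ i $ j)) * (- u $ i))"
    using assms by (intro sum_nonneg mult_nonneg_nonneg)
      (auto simp: tp_feasible_def tp_dual_feasible_def)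
  ultimately show ?thesis
    using duality_gap_eq[OF assms(1), of c u v] by linarith
qed

section \<open>Strong duality\<close>

definition complementary_costs :: "real ^ 'm \<Rightarrow> real ^ 'n ^ 'm \<Rightarrow> (real ^ 'n ^ 'm) set"
  where "complementary_costs s x = {c. \<exists>u v. tp_dual_feasible c u v \<and>
    (\<forall>i j. x $ i $ j \<noteq> 0 \<longrightarrow> u $ i + v $ j = c $ i $ j) \<and>
    (\<forall>i. (\<Sum>j\<in>UNIV. x $ i $ j) \<noteq> s $ i \<longrightarrow> u $ i = 0)}"

lemma convex_cone_complementary_costs: "convex_cone (complementary_costs s x)"
  unfolding convex_cone_iff
proof (intro conjI ballI allI impI)
  show "0 \<in> complementary_costs s x"
    unfolding complementary_costs_def tp_dual_feasible_def
    by (intro CollectI exI[where x = 0]) simp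
next
  fix c c' assume "c \<in> complementary_costs s x" "c' \<in> complementary_costs s x"
  then obtain u v u' v'
    where u: "\<And>i j. u $ i + v $ j \<le> c $ i $ j" "\<And>i. u $ i \<le> 0"
      "\<And>i j. x $ i $ j \<noteq> 0 \<Longrightarrow> u $ i + v $ j = c $ i $ j"
      "\<And>i. (\<Sum>j\<in>UNIV. x $ i $ j) \<noteq> s $ i \<Longrightarrow> u $ i = 0"
    and u': "\<And>i j. u' $ i + v' $ j \<le> c' $ i $ j" "\<And>i. u' $ i \<le> 0"
      "\<And>i j. x $ i $ j \<noteq> 0 \<Longrightarrow> u' $ i + v' $ j = c' $ i $ j"
      "\<And>i. (\<Sum>j\<in>UNIV. x $ i $ j) \<noteq> s $ i \<Longrightarrow> u' $ i = 0"
    unfolding complementary_costs_def tp_dual_feasible_def by blast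
  show "c + c' \<in> complementary_costs s x"
    unfolding complementary_costs_def tp_dual_feasible_def
    using add_mono[OF u(1) u'(1)]
    by (intro CollectI exI[where x = "u + u'"] exI[where x = "v + v'"])
      (auto simp: u u' add_nonpos_nonpos ac_simps simp flip: u(3) u'(3))
next
  fix c and t :: real assume "c \<in> complementary_costs s x" "0 \<le> t"
  then obtain u v where
    "tp_dual_feasible c u v" "\<forall>i j. x $ i $ j \<noteq> 0 \<longrightarrow> u $ i + v $ j = c $ i $ j"
    "\<forall>i. (\<Sum>j\<in>UNIV. x $ i $ j) \<noteq> s $ i \<longrightarrow> u $ i = 0"
    unfolding complementary_costs_def by blast
  with \<open>0 \<le> t\<close> show "t *\<^sub>R c \<in> complementary_costs s x"
    unfolding complementary_costs_def tp_dual_feasible_def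
    by (intro CollectI exI[where x = "t *\<^sub>R u"] exI[where x = "t *\<^sub>R v"])
      (auto simp: mult_nonneg_nonpos mult_left_mono simp flip: distrib_left)
qed

text \<open>
  The normals of the constraints that are active at \<^term>\<open>x\<close>: a direction with nonnegative inner
  product with all of them respects the nonnegativity of the unused routes, the demands (equations,
  whence both signs) and the exhausted supplies.
\<close>
definition active_constraints :: "real ^ 'm \<Rightarrow> real ^ 'n ^ 'm \<Rightarrow> (real ^ 'n ^ 'm) set"
  where "active_constraints s x =
    {axis i (axis j 1) | i j. x $ i $ j = 0}
    \<union> {(\<chi> i. axis j 1) | j. True}
    \<union> {- (\<chi> i. axis j 1) | j. True}
    \<union> {- axis i 1 | i. (\<Sum>j\<in>UNIV. x $ i $ j) = s $ i}"

lemma finite_active_constraints: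
  fixes x :: "real ^ 'n ^ 'm"
  shows "finite (active_constraints s x)"
  unfolding active_constraints_def
proof (intro finite_UnI)
  have "finite {axis i (axis j 1) :: real ^ 'n ^ 'm | i j. True \<and> True}"
    by (intro finite_image_set2) auto
  then show "finite {axis i (axis j 1) :: real ^ 'n ^ 'm | i j. x $ i $ j = 0}"
    by (rule rev_finite_subset) auto
qed (auto simp: full_SetCompr_eq finite_image_set)

lemma inner_active_constraints_nonneg_iff:
  fixes x y :: "real ^ 'n ^ 'm"
  shows "(\<forall>a\<in>active_constraints s x. 0 \<le> y \<bullet> a) \<longleftrightarrow>
    (\<forall>i j. x $ i $ j = 0 \<longrightarrow> 0 \<le> y $ i $ j) \<and>
    (\<forall>j. (\<Sum>i\<in>UNIV. y $ i $ j) = 0) \<and>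
    (\<forall>i. (\<Sum>j\<in>UNIV. x $ i $ j) = s $ i \<longrightarrow> (\<Sum>j\<in>UNIV. y $ i $ j) \<le> 0)"
proof -
  have entry: "y \<bullet> axis i (axis j 1) = y $ i $ j" for i j
    by (simp add: inner_axis)
  have column: "y \<bullet> (\<chi> i. axis j 1) = (\<Sum>i\<in>UNIV. y $ i $ j)" for j
    by (simp add: inner_vec_def[of y] inner_axis)
  have row: "y \<bullet> axis i 1 = (\<Sum>j\<in>UNIV. y $ i $ j)" for i
    unfolding inner_axis by (simp add: inner_vec_def)
  have zero_iff: "(\<Sum>i\<in>UNIV. y $ i $ j) = 0 \<longleftrightarrow>
      0 \<le> (\<Sum>i\<in>UNIV. y $ i $ j) \<and> (\<Sum>i\<in>UNIV. y $ i $ j) \<le> 0" for j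
    by (rule order_eq_iff[THEN trans]) (rule conj_commute)
  have "(\<forall>a\<in>active_constraints s x. 0 \<le> y \<bullet> a) \<longleftrightarrow>
      (\<forall>i j. x $ i $ j = 0 \<longrightarrow> 0 \<le> y \<bullet> axis i (axis j 1)) \<and>
      (\<forall>j. 0 \<le> y \<bullet> (\<chi> i. axis j 1)) \<and> (\<forall>j. 0 \<le> y \<bullet> - (\<chi> i. axis j 1)) \<and>
      (\<forall>i. (\<Sum>j\<in>UNIV. x $ i $ j) = s $ i \<longrightarrow> 0 \<le> y \<bullet> - axis i 1)"
    unfolding active_constraints_def by blast
  then show ?thesis
    unfolding inner_minus_right entry column row neg_0_le_iff_le
    unfolding zero_iff all_conj_distrib by (simp only: conj_ac)
qed

text \<open>
  Each normal has obvious potentials: a unit cost on an unused route needs none, a column is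
  priced by its destination, and a negated row by its source.
\<close>
lemma active_constraints_subset_complementary_costs:
  "active_constraints s x \<subseteq> complementary_costs s x"
proof
  fix a assume "a \<in> active_constraints s x"
  then consider (entry) i j where "a = axis i (axis j 1)" "x $ i $ j = 0"
    | (column) j where "a = (\<chi> i. axis j 1)"
    | (column_neg) j where "a = - (\<chi> i. axis j 1)"
    | (row) i where "a = - axis i 1" "(\<Sum>j\<in>UNIV. x $ i $ j) = s $ i"
    unfolding active_constraints_def by blast
  then show "a \<in> complementary_costs s x"
  proof cases
    case entry
    then show ?thesis
      unfolding complementary_costs_def tp_dual_feasible_def
      by (intro CollectI exI[where x = 0]) (auto simp: axis_def)
  next
    case column
    then show ?thesis
      unfolding complementary_costs_def tp_dual_feasible_def
      by (intro CollectI exI[where x = 0] exI[where x = "axis j 1"]) (auto simp: axis_def)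
  next
    case column_neg
    then show ?thesis
      unfolding complementary_costs_def tp_dual_feasible_def
      by (intro CollectI exI[where x = 0] exI[where x = "- axis j 1"]) (auto simp: axis_def)
  next
    case row
    then show ?thesis
      unfolding complementary_costs_def tp_dual_feasible_def
      by (intro CollectI exI[where x = "- axis i 1"] exI[where x = 0]) (auto simp: axis_def)
  qed
qed

lemma eventually_at_right_affine_nonneg:
  fixes a b :: real
  assumes "0 \<le> a" and "a = 0 \<Longrightarrow> 0 \<le> b"
  shows "\<forall>\<^sub>F t in at_right 0. 0 \<le> a + t * b"
proof (cases "a = 0")
  case True
  then show ?thesis
    using assms(2) eventually_at_right_less[of "0 :: real"] by (auto elim: eventually_mono)
next
  case False
  have "((\<lambda>t. a + t * b) \<longlongrightarrow> a + 0 * b) (at_right 0)"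
    by (intro tendsto_intros)
  then have "\<forall>\<^sub>F t in at_right 0. 0 < a + t * b"
    using False assms(1) by (intro order_tendstoD(1)) auto
  then show ?thesis
    by (rule eventually_mono) simp
qed

text \<open>
  Constraints with slack at \<^term>\<open>x\<close> survive a small step in any direction, so only the active ones
  restrict the direction. There are finitely many constraints, hence one step works for all.
\<close>
lemma feasible_step:
  fixes x y :: "real ^ 'n ^ 'm"
  assumes x: "tp_feasible s d x" and y: "\<forall>a\<in>active_constraints s x. 0 \<le> y \<bullet> a"
  obtains t where "0 < t" and "tp_feasible s d (x + t *\<^sub>R y)"
proof -
  note x = x[unfolded tp_feasible_def] and y = y[unfolded inner_active_constraints_nonneg_iff]
  have "\<forall>\<^sub>F t in at_right 0. \<forall>i j. 0 \<le> x $ i $ j + t * y $ i $ j"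
    using x y by (intro eventually_all_finite eventually_at_right_affine_nonneg) auto
  moreover have "\<forall>\<^sub>F t in at_right 0. \<forall>i.
      0 \<le> (s $ i - (\<Sum>j\<in>UNIV. x $ i $ j)) + t * - (\<Sum>j\<in>UNIV. y $ i $ j)"
    using x y by (intro eventually_all_finite eventually_at_right_affine_nonneg) auto
  ultimately have "\<forall>\<^sub>F t in at_right 0. 0 < t \<and> (\<forall>i j. 0 \<le> x $ i $ j + t * y $ i $ j) \<and>
      (\<forall>i. 0 \<le> (s $ i - (\<Sum>j\<in>UNIV. x $ i $ j)) + t * - (\<Sum>j\<in>UNIV. y $ i $ j))"
    by (intro eventually_conj eventually_at_right_less)
  then obtain t where "0 < t" and t: "\<forall>i j. 0 \<le> x $ i $ j + t * y $ i $ j"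
      "\<forall>i. 0 \<le> (s $ i - (\<Sum>j\<in>UNIV. x $ i $ j)) + t * - (\<Sum>j\<in>UNIV. y $ i $ j)"
    using eventually_happens'[OF trivial_limit_at_right_real] by blast
  have "tp_feasible s d (x + t *\<^sub>R y)"
    using t x y by (simp add: tp_feasible_def sum.distrib algebra_simps flip: sum_distrib_left)
  with \<open>0 < t\<close> show thesis
    by (rule that)
qed

text \<open>
  A Farkas argument: a point outside a finitely generated (hence closed) convex cone is separated
  from it by a hyperplane, which can be taken through the origin because the cone is invariant
  under scaling.
\<close>
lemma separate_from_finitely_generated_cone:
  fixes S :: "'a::euclidean_space set"
  assumes "finite S" and "c \<notin> convex_cone hull S"
  obtains y where "y \<bullet> c < 0" and "\<forall>a\<in>S. 0 \<le> y \<bullet> a"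
proof -
  let ?K = "convex_cone hull S"
  obtain y b where c: "y \<bullet> c < b" and K: "\<forall>k\<in>?K. b < y \<bullet> k"
    using separating_hyperplane_closed_point[OF convex_convex_cone_hull
        closed_convex_cone_hull[OF assms(1)] assms(2)] by blast
  have "b < 0"
    using K convex_cone_hull_contains_0[of S] by force
  have "0 \<le> y \<bullet> a" if "a \<in> S" for a
  proof (rule ccontr)
    assume neg: "\<not> 0 \<le> y \<bullet> a"
    \<comment> \<open>the multiple of \<^term>\<open>a\<close> that lies on the bounding hyperplane\<close>
    have "(b / (y \<bullet> a)) *\<^sub>R a \<in> ?K"
      using that neg \<open>b < 0\<close>
      by (intro convex_cone_hull_mul hull_inc) (auto simp: divide_nonpos_nonpos)
    with K have "b < y \<bullet> ((b / (y \<bullet> a)) *\<^sub>R a)"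
      by blast
    with neg show False
      by simp
  qed
  with c \<open>b < 0\<close> show thesis
    by (intro that[of y]) auto
qed

lemma optimal_imp_complementary_costs:
  assumes "tp_optimal c s d x"
  shows "c \<in> complementary_costs s x"
proof -
  have x: "tp_feasible s d x"
    using assms by (simp add: tp_optimal_def)
  have "c \<in> convex_cone hull active_constraints s x"
  proof (rule ccontr)
    assume "c \<notin> convex_cone hull active_constraints s x"
    then obtain y where y: "y \<bullet> c < 0" "\<forall>a\<in>active_constraints s x. 0 \<le> y \<bullet> a"
      using separate_from_finitely_generated_cone[OF finite_active_constraints] by blast
    obtain t where t: "0 < t" "tp_feasible s d (x + t *\<^sub>R y)"
      using feasible_step[OF x y(2)] by blast
    have "c \<bullet> x \<le> c \<bullet> (x + t *\<^sub>R y)"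
      using assms t(2) by (simp add: tp_optimal_def tp_cost_eq_inner)
    then have "0 \<le> t * (y \<bullet> c)"
      by (simp add: inner_right_distrib inner_commute)
    then show False
      using t(1) y(1) by (simp add: zero_le_mult_iff)
  qed
  then show ?thesis
    using hull_minimal[where S = convex_cone, OF active_constraints_subset_complementary_costs
        convex_cone_complementary_costs] by blast
qed

lemma tp_optimal_iff_dual:
  "tp_optimal c s d x \<longleftrightarrow>
    tp_feasible s d x \<and> (\<exists>u v. tp_dual_feasible c u v \<and> tp_cost c x = tp_dual_value s d u v)"
proof (intro iffI conjI)
  assume opt: "tp_optimal c s d x"
  then show x: "tp_feasible s d x"
    by (simp add: tp_optimal_def)
  obtain u v where uv: "tp_dual_feasible c u v"
    and route: "\<forall>i j. x $ i $ j \<noteq> 0 \<longrightarrow> u $ i + v $ j = c $ i $ j"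
    and source: "\<forall>i. (\<Sum>j\<in>UNIV. x $ i $ j) \<noteq> s $ i \<longrightarrow> u $ i = 0"
    using optimal_imp_complementary_costs[OF opt] by (auto simp: complementary_costs_def)
  have "(c $ i $ j - u $ i - v $ j) * x $ i $ j = 0" for i j
    using route[rule_format, of i j] by auto
  moreover have "(s $ i - (\<Sum>j\<in>UNIV. x $ i $ j)) * (- u $ i) = 0" for i
    using source by (metis diff_self minus_zero mult_zero_left mult_zero_right)
  ultimately have "tp_cost c x - tp_dual_value s d u v = 0"
    unfolding duality_gap_eq[OF x] by (simp only: sum.neutral_const add_0)
  with uv show "\<exists>u v. tp_dual_feasible c u v \<and> tp_cost c x = tp_dual_value s d u v"
    by auto
next
  assume "tp_feasible s d x \<and>
    (\<exists>u v. tp_dual_feasible c u v \<and> tp_cost c x = tp_dual_value s d u v)"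
  then show "tp_optimal c s d x"
    using weak_duality unfolding tp_optimal_def by metis
qed

section \<open>The least admissible supplies\<close>

lemma tp_optimal_antimono_supply:
  assumes "tp_optimal c s' d x" and "tp_feasible s d x" and "s \<le> s'"
  shows "tp_optimal c s d x"
proof -
  have "tp_feasible s' d y" if "tp_feasible s d y" for y
    using that \<open>s \<le> s'\<close> unfolding tp_feasible_def less_eq_vec_def by (meson order_trans)
  then show ?thesis
    using assms(1,2) by (auto simp: tp_optimal_def)
qed

theorem proposition4:
  fixes c_lo c_hi :: "real ^ 'n ^ 'm"
    and s_lo s_hi :: "real ^ 'm"
    and d_lo d_hi :: "real ^ 'n"
    and x :: "real ^ 'n ^ 'm"
  assumes "0 \<le> c_lo" "c_lo \<le> c_hi"
    and "0 \<le> s_lo" "s_lo \<le> s_hi"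
    and "0 \<le> d_lo" "d_lo \<le> d_hi"
  shows "itp_weakly_optimal {c_lo..c_hi} {s_lo..s_hi} {d_lo..d_hi} x \<longleftrightarrow>
    itp_weakly_feasible {c_lo..c_hi} {s_lo..s_hi} {d_lo..d_hi} x \<and>
    (let s = (\<chi> i. max (s_lo $ i) (\<Sum>j\<in>UNIV. x $ i $ j)) :: real ^ 'm;
         d = (\<chi> j. \<Sum>i\<in>UNIV. x $ i $ j) :: real ^ 'n
     in \<exists>(u :: real ^ 'm) (v :: real ^ 'n) (c :: real ^ 'n ^ 'm).
          (\<Sum>i\<in>UNIV. \<Sum>j\<in>UNIV. c $ i $ j * x $ i $ j) =
            (\<Sum>i\<in>UNIV. s $ i * u $ i) + (\<Sum>j\<in>UNIV. d $ j * v $ j) \<and>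
          (\<forall>i j. u $ i + v $ j \<le> c $ i $ j) \<and>
          (\<forall>i. u $ i \<le> 0) \<and>
          (\<forall>i j. c_lo $ i $ j \<le> c $ i $ j \<and> c $ i $ j \<le> c_hi $ i $ j))"
proof -
  define s where "s = (\<chi> i. max (s_lo $ i) (\<Sum>j\<in>UNIV. x $ i $ j))"
  define d where "d = (\<chi> j. \<Sum>i\<in>UNIV. x $ i $ j)"
  have reduced: "s \<in> {s_lo..s_hi} \<and> d \<in> {d_lo..d_hi} \<and> tp_feasible s d x \<and> s \<le> s' \<and> d' = d"
    if "s' \<in> {s_lo..s_hi}" "d' \<in> {d_lo..d_hi}" "tp_feasible s' d' x" for s' d'
  proof -
    have "d' = d"
      using that(3) by (simp add: tp_feasible_def d_def vec_eq_iff)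
    moreover have "s_lo \<le> s" and le: "s \<le> s'"
      using that by (auto simp: tp_feasible_def s_def less_eq_vec_def)
    moreover have "tp_feasible s d x"
      using that(3) by (simp add: tp_feasible_def s_def d_def)
    ultimately show ?thesis
      using that(1,2) by auto
  qed
  have "itp_weakly_optimal {c_lo..c_hi} {s_lo..s_hi} {d_lo..d_hi} x \<longleftrightarrow>
      itp_weakly_feasible {c_lo..c_hi} {s_lo..s_hi} {d_lo..d_hi} x \<and>
      (\<exists>c\<in>{c_lo..c_hi}. tp_optimal c s d x)"
  proof (intro iffI conjI)
    assume "itp_weakly_optimal {c_lo..c_hi} {s_lo..s_hi} {d_lo..d_hi} x"
    then obtain c s' d' where c: "c \<in> {c_lo..c_hi}" and s': "s' \<in> {s_lo..s_hi}"
      and d': "d' \<in> {d_lo..d_hi}" and opt: "tp_optimal c s' d' x"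
      by (auto simp: itp_weakly_optimal_def)
    from opt have feas: "tp_feasible s' d' x"
      by (simp add: tp_optimal_def)
    with c s' d' show "itp_weakly_feasible {c_lo..c_hi} {s_lo..s_hi} {d_lo..d_hi} x"
      unfolding itp_weakly_feasible_def by blast
    show "\<exists>c\<in>{c_lo..c_hi}. tp_optimal c s d x"
      using reduced[OF s' d' feas] opt c tp_optimal_antimono_supply by blast
  next
    assume "itp_weakly_feasible {c_lo..c_hi} {s_lo..s_hi} {d_lo..d_hi} x \<and>
      (\<exists>c\<in>{c_lo..c_hi}. tp_optimal c s d x)"
    then show "itp_weakly_optimal {c_lo..c_hi} {s_lo..s_hi} {d_lo..d_hi} x"
      unfolding itp_weakly_feasible_def itp_weakly_optimal_def using reduced by blast
  qed
  also have "\<dots> \<longleftrightarrow> itp_weakly_feasible {c_lo..c_hi} {s_lo..s_hi} {d_lo..d_hi} x \<and>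
      (\<exists>c\<in>{c_lo..c_hi}. \<exists>u v. tp_dual_feasible c u v \<and> tp_cost c x = tp_dual_value s d u v)"
    unfolding tp_optimal_iff_dual itp_weakly_feasible_def using reduced by blast
  also have "\<dots> \<longleftrightarrow> itp_weakly_feasible {c_lo..c_hi} {s_lo..s_hi} {d_lo..d_hi} x \<and>
      (\<exists>u v c. tp_cost c x = tp_dual_value s d u v \<and>
        (\<forall>i j. u $ i + v $ j \<le> c $ i $ j) \<and> (\<forall>i. u $ i \<le> 0) \<and>
        (\<forall>i j. c_lo $ i $ j \<le> c $ i $ j \<and> c $ i $ j \<le> c_hi $ i $ j))"
    unfolding tp_dual_feasible_def atLeastAtMost_iff less_eq_vec_def Bex_def by blast
  finally show ?thesis
    by (simp add: Let_def tp_cost_def tp_dual_value_def flip: s_def d_def)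
qed

end
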